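(* (Associated big $q$-Laguerre case.) Let $0<|q|<1$, let $A,B,C$ be nonzero complex numbers, and let $$a_n=\Big(\tfrac1A+\tfrac1B+\tfrac1C\Big)q^n-(1+q)q^{2n-1},\qquad b_n^2=-\frac{q^n}{ABC}(1-Aq^{n-1})(1-Bq^{n-1})(1-Cq^{n-1}),$$ with $b_n^2\neq0$ for $n\ge1$. Then for $z\ne0$ for which the right-hand side is defined, $$\cfrac{1}{z-a_0-\cfrac{b_1^2}{z-a_1-\cfrac{b_2^2}{z-a_2-\cdots}}}=\frac{{}_2\phi_1\left(\begin{matrix}B,\,C\\ q/(Az)\end{matrix};\frac{q}{BCz}\right)}{z\left(1-\frac1{Az}\right){}_2\phi_1\left(\begin{matrix}B/q,\,C/q\\ 1/(Az)\end{matrix};\frac{q}{BCz}\right)}.$$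
   Context: Notation: $(a)_k=\prod_{j=0}^{k-1}(1-aq^j)$ and ${}_2\phi_1\left(\begin{matrix}a,b\\ c\end{matrix};w\right)=\sum_{k\ge0}\frac{(a)_k(b)_k}{(c)_k(q)_k}w^k$ for $|w|<1$, and by analytic (meromorphic) continuation in $w$ for $|w|\ge1$. "Defined" means that no lower parameter is of the form $q^{-k}$ ($k\ge0$), the argument is not a pole of the continuation, and the denominator does not vanish. *)

theory Defs
  imports "HOL-Complex_Analysis.Complex_Analysis"
begin

definition qpoch :: "complex \<Rightarrow> complex \<Rightarrow> nat \<Rightarrow> complex" where
  "qpoch q a k = (\<Prod>j<k. 1 - a * q ^ j)"

definition phi21_series :: "complex \<Rightarrow> complex \<Rightarrow> complex \<Rightarrow> complex \<Rightarrow> complex \<Rightarrow> complex" where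
  "phi21_series q a b c w =
     (\<Sum>k. qpoch q a k * qpoch q b k / (qpoch q c k * qpoch q q k) * w ^ k)"

text \<open>The meromorphic continuation of the series from the unit disc to the whole plane. A nicely
  meromorphic function has its removable singularities removed and takes the value 0 at its poles,
  so there is at most one such continuation; the value at a pole carries no meaning.\<close>

definition phi21 :: "complex \<Rightarrow> complex \<Rightarrow> complex \<Rightarrow> complex \<Rightarrow> complex \<Rightarrow> complex" where
  "phi21 q a b c =
     (THE F. F nicely_meromorphic_on UNIV \<and> (\<forall>w. norm w < 1 \<longrightarrow> F w = phi21_series q a b c w))"

text \<open>Numerators and denominators of the approximants of the continued fraction
  \<open>c 0 / (d 0 + c 1 / (d 1 + c 2 / (d 2 + \<dots>)))\<close>; index \<open>n\<close> belongs to the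
  approximant that uses the first \<open>n\<close> partial quotients.\<close>

fun cf_num :: "(nat \<Rightarrow> complex) \<Rightarrow> (nat \<Rightarrow> complex) \<Rightarrow> nat \<Rightarrow> complex" where
  "cf_num c d 0 = 0"
| "cf_num c d (Suc 0) = c 0"
| "cf_num c d (Suc (Suc n)) = d (Suc n) * cf_num c d (Suc n) + c (Suc n) * cf_num c d n"

fun cf_den :: "(nat \<Rightarrow> complex) \<Rightarrow> (nat \<Rightarrow> complex) \<Rightarrow> nat \<Rightarrow> complex" where
  "cf_den c d 0 = 1"
| "cf_den c d (Suc 0) = d 0"
| "cf_den c d (Suc (Suc n)) = d (Suc n) * cf_den c d (Suc n) + c (Suc n) * cf_den c d n"

text \<open>As usual, finitely many approximants may be infinite (zero denominator).\<close>

definition cf_has_value :: "(nat \<Rightarrow> complex) \<Rightarrow> (nat \<Rightarrow> complex) \<Rightarrow> complex \<Rightarrow> bool" where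
  "cf_has_value c d L \<longleftrightarrow>
     (\<forall>\<^sub>F n in sequentially. cf_den c d n \<noteq> 0) \<and>
     (\<lambda>n. cf_num c d n / cf_den c d n) \<longlonglongrightarrow> L"

text \<open>The recurrences compute the nested finite fraction whenever the latter can be evaluated
  without dividing by zero (\<open>t k\<close> is the part of the fraction from level \<open>k\<close> on).\<close>

lemma cf_num_div_den_eq_nested:
  fixes t :: "nat \<Rightarrow> complex"
  assumes t_end: "t n = 0"
    and t_step: "\<And>k. k < n \<Longrightarrow> t k = c k / (d k + t (Suc k))"
    and nz: "\<And>k. k < n \<Longrightarrow> d k + t (Suc k) \<noteq> 0"
  shows "cf_den c d n \<noteq> 0" and "t 0 = cf_num c d n / cf_den c d n"
proof -
  have step: "c k = t k * (d k + t (Suc k))" if "k < n" for k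
    using t_step[OF that] nz[OF that] by simp
  have main: "cf_den c d (Suc m) + cf_den c d m * t (Suc m) \<noteq> 0 \<and>
      t 0 * (cf_den c d (Suc m) + cf_den c d m * t (Suc m))
        = cf_num c d (Suc m) + cf_num c d m * t (Suc m)" if "Suc m \<le> n" for m
    using that
  proof (induction m)
    case 0
    then show ?case using step[of 0] nz[of 0] by simp
  next
    case (Suc m)
    let ?u = "d (Suc m) + t (Suc (Suc m))"
    have c: "c (Suc m) = t (Suc m) * ?u" and u: "?u \<noteq> 0"
      using Suc.prems step[of "Suc m"] nz[of "Suc m"] by simp_all
    have den: "cf_den c d (Suc (Suc m)) + cf_den c d (Suc m) * t (Suc (Suc m))
        = ?u * (cf_den c d (Suc m) + cf_den c d m * t (Suc m))"
      by (simp add: c algebra_simps)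
    have num: "cf_num c d (Suc (Suc m)) + cf_num c d (Suc m) * t (Suc (Suc m))
        = ?u * (cf_num c d (Suc m) + cf_num c d m * t (Suc m))"
      by (simp add: c algebra_simps)
    from Suc show ?case unfolding den num using u by simp
  qed
  have "cf_den c d n \<noteq> 0 \<and> t 0 * cf_den c d n = cf_num c d n"
  proof (cases n)
    case 0
    then show ?thesis using t_end by simp
  next
    case (Suc m)
    then show ?thesis using main[of m] t_end by simp
  qed
  then show "cf_den c d n \<noteq> 0" and "t 0 = cf_num c d n / cf_den c d n"
    by (simp_all add: field_simps)
qed

end

(* With alpha = B/q, beta = C/q, gamma = 1/(A z) and w = q/(B C z), let G_n be the product of
   (w)_infinity and the series 2phi1(alpha q^n, beta q^n; gamma q^n; w). The q-difference equation
   of the series in w shows that G_n continues to an entire function of w, and a contiguous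
   relation, continued analytically from the unit disc, says that X_n = G_n / ((gamma)_n z^n)
   solves X_n = (z - a_n) X_{n+1} - b_{n+1}^2 X_{n+2}. Since G_n tends to 1, the sequence X_n z^n
   has a nonzero limit; as a_n and b_n^2 are summable, comparing X with the numerators and
   denominators of the approximants gives the value X_1 / X_0 (a form of Pincherle's theorem),
   and the factor (w)_infinity cancels in this quotient. *)
theory Submission
  imports Defs
begin

subsection \<open>q-Pochhammer symbols\<close>

text \<open>The obstacle is that \<open>w\<close> may lie outside the unit disc, where no series is
  available, or at a zero q^(-j) of (w)_infinity. The function \<open>phi21\<close> is given only by
  a description and takes the value 0 at its poles, so it cannot carry a recurrence itself. Poles of
  the continuation can occur only at zeros of (w)_infinity, and this factor is common to all n
  because the contiguous relation moves the three parameters and leaves w fixed. Hence the entire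
  functions G_n satisfy one recurrence at every w. The limit 1 of G_n comes from Euler's identity
  (w)_infinity * sum w^k / (q)_k = 1, since all three parameters tend to 0. For the comparison with
  the approximants: their numerators and denominators are O(z^n), while X_n is of exact order
  z^(-n). In the identity linking them, the second term carries an extra factor b_(n+1)^2 and
  vanishes in the limit.\<close>

lemma qpoch_0 [simp]: "qpoch q a 0 = 1"
  by (simp add: qpoch_def)

lemma qpoch_Suc: "qpoch q a (Suc k) = qpoch q a k * (1 - a * q ^ k)"
  by (simp add: qpoch_def)

lemma qpoch_Suc_shift: "qpoch q a (Suc k) = (1 - a) * qpoch q (a * q) k"
  unfolding qpoch_def by (subst prod.lessThan_Suc_shift) (simp add: mult.assoc)

lemma qpoch_add: "qpoch q a (n + k) = qpoch q a n * qpoch q (a * q ^ n) k"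
  by (induction k) (simp_all add: qpoch_Suc power_add mult_ac)

lemma qpoch_nonzero: "(\<And>j. a * q ^ j \<noteq> 1) \<Longrightarrow> qpoch q a k \<noteq> 0"
  by (simp add: qpoch_def)

definition qpoch_inf :: "complex \<Rightarrow> complex \<Rightarrow> complex" where
  "qpoch_inf q a = (\<Prod>j. 1 - a * q ^ j)"

lemma qpoch_norm_le:
  assumes "norm q < 1"
  shows "norm (qpoch q a k) \<le> exp (norm a / (1 - norm q))"
proof -
  have "norm (qpoch q a k) \<le> (\<Prod>j<k. exp (norm a * norm q ^ j))"
    unfolding qpoch_def prod_norm[symmetric]
  proof (rule prod_mono, safe)
    fix j
    have "norm (1 - a * q ^ j) \<le> 1 + norm a * norm q ^ j"
      using norm_triangle_ineq4[of 1 "a * q ^ j"] by (simp add: norm_mult norm_power)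
    also have "\<dots> \<le> exp (norm a * norm q ^ j)"
      by (rule exp_ge_add_one_self)
    finally show "norm (1 - a * q ^ j) \<le> exp (norm a * norm q ^ j)" .
  qed auto
  also have "\<dots> = exp (norm a * (\<Sum>j<k. norm q ^ j))"
    by (simp add: exp_sum sum_distrib_left)
  also have "(\<Sum>j<k. norm q ^ j) \<le> (\<Sum>j. norm q ^ j)"
    by (rule sum_le_suminf) (use assms in \<open>auto intro: summable_geometric\<close>)
  also have "(\<Sum>j. norm q ^ j) = 1 / (1 - norm q)"
    by (rule suminf_geometric) (use assms in simp)
  finally show ?thesis
    by (simp add: mult_left_mono)
qed

lemma convergent_prod_qpoch:
  assumes "norm (q::complex) < 1"
  shows "convergent_prod (\<lambda>j. 1 - a * q ^ j)"
proof -
  have "summable (\<lambda>j. norm (a * q ^ j))"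
    unfolding norm_mult norm_power
    by (intro summable_mult summable_geometric) (use assms in auto)
  then show ?thesis
    by (intro abs_convergent_prod_imp_convergent_prod summable_imp_abs_convergent_prod) simp
qed

lemma qpoch_tendsto:
  assumes "norm q < 1"
  shows "qpoch q a \<longlonglongrightarrow> qpoch_inf q a"
proof -
  have "(\<lambda>n. \<Prod>j\<le>n. 1 - a * q ^ j) \<longlonglongrightarrow> qpoch_inf q a"
    unfolding qpoch_inf_def by (rule convergent_prod_LIMSEQ[OF convergent_prod_qpoch[OF assms]])
  then have "(\<lambda>n. qpoch q a (Suc n)) \<longlonglongrightarrow> qpoch_inf q a"
    by (simp add: qpoch_def lessThan_Suc_atMost)
  then show ?thesis
    by (rule LIMSEQ_imp_Suc)
qed

lemma qpoch_inf_shift: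
  assumes "norm q < 1"
  shows "qpoch_inf q a = (1 - a) * qpoch_inf q (a * q)"
proof (rule LIMSEQ_unique)
  show "(\<lambda>k. qpoch q a (Suc k)) \<longlonglongrightarrow> qpoch_inf q a"
    using qpoch_tendsto[OF assms] by (rule LIMSEQ_Suc)
  show "(\<lambda>k. qpoch q a (Suc k)) \<longlonglongrightarrow> (1 - a) * qpoch_inf q (a * q)"
    unfolding qpoch_Suc_shift by (intro tendsto_intros qpoch_tendsto assms)
qed

lemma qpoch_inf_nonzero:
  assumes "norm q < 1" "\<And>j. a * q ^ j \<noteq> 1"
  shows "qpoch_inf q a \<noteq> 0"
  unfolding qpoch_inf_def
  by (rule prodinf_nonzero[OF convergent_prod_qpoch[OF assms(1)]]) (use assms(2) in \<open>metis eq_iff_diff_eq_0\<close>)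

lemma qpoch_inf_holomorphic:
  assumes "norm q < 1"
  shows "qpoch_inf q holomorphic_on UNIV"
proof (rule holomorphic_uniform_sequence)
  show "(\<lambda>a. qpoch q a n) holomorphic_on UNIV" for n
    unfolding qpoch_def by (intro holomorphic_intros)
  fix x :: complex
  have "uniformly_convergent_on (cball x 1) (\<lambda>N a. \<Prod>j<N. 1 - a * q ^ j)"
  proof (rule uniformly_convergent_on_prod')
    show "uniformly_convergent_on (cball x 1) (\<lambda>N a. \<Sum>j<N. norm (1 - a * q ^ j - 1))"
    proof (rule Weierstrass_m_test')
      fix j a assume "a \<in> cball x 1"
      then have "norm a \<le> norm x + 1"
        using norm_triangle_ineq2[of a x] by (auto simp: dist_norm norm_minus_commute)
      then show "norm (norm (1 - a * q ^ j - 1)) \<le> (norm x + 1) * norm q ^ j"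
        by (simp add: norm_mult norm_power mult_right_mono)
    next
      show "summable (\<lambda>j. (norm x + 1) * norm q ^ j)"
        by (intro summable_mult summable_geometric) (use assms in auto)
    qed
  qed (auto intro!: continuous_intros)
  then obtain l where l: "uniform_limit (cball x 1) (\<lambda>N a. qpoch q a N) l sequentially"
    unfolding uniformly_convergent_on_def qpoch_def by blast
  have "l a = qpoch_inf q a" if "a \<in> cball x 1" for a
    using tendsto_uniform_limitI[OF l that] qpoch_tendsto[OF assms] by (rule LIMSEQ_unique)
  then have "uniform_limit (cball x 1) (\<lambda>N a. qpoch q a N) (qpoch_inf q) sequentially"
    by (intro iffD1[OF uniform_limit_cong' l]) auto
  then show "\<exists>d>0. cball x d \<subseteq> UNIV \<and> uniform_limit (cball x d) (\<lambda>N a. qpoch q a N) (qpoch_inf q) sequentially"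
    by (intro exI[of _ 1]) auto
qed auto

text \<open>By \<open>qpoch_add\<close>, (c q^n)_k is the quotient of (c)_(n+k) and (c)_n. The
  reciprocals of the (c)_m converge, hence are bounded, and the (c)_n are bounded as well; so the
  bound is uniform in \<open>n\<close> and \<open>k\<close>.\<close>

lemma qpoch_norm_ge:
  assumes "norm q < 1" "\<And>j. c * q ^ j \<noteq> 1"
  obtains d where "d > 0" "\<And>n k. d \<le> norm (qpoch q (c * q ^ n) k)"
proof -
  define M where "M = exp (norm c / (1 - norm q))"
  have nz: "qpoch q c n \<noteq> 0" for n
    by (rule qpoch_nonzero) (rule assms(2))
  have "(\<lambda>n. inverse (qpoch q c n)) \<longlonglongrightarrow> inverse (qpoch_inf q c)"
    by (intro tendsto_inverse qpoch_tendsto qpoch_inf_nonzero assms)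
  then have "Bseq (\<lambda>n. inverse (qpoch q c n))"
    by (rule convergent_imp_Bseq[OF convergentI])
  then obtain K where K: "K > 0" "\<And>n. norm (inverse (qpoch q c n)) \<le> K"
    unfolding Bseq_def by blast
  have M: "M > 0" by (simp add: M_def)
  show ?thesis
  proof
    show "inverse (K * M) > 0" using K M by simp
    fix n k
    have eq: "qpoch q c n * inverse (qpoch q c (n + k)) * qpoch q (c * q ^ n) k = 1"
      using nz[of n] nz[of "n + k"] unfolding qpoch_add by (simp add: field_simps)
    have "1 = norm (qpoch q c n) * norm (inverse (qpoch q c (n + k))) * norm (qpoch q (c * q ^ n) k)"
      by (metis eq norm_mult norm_one)
    also have "\<dots> \<le> M * K * norm (qpoch q (c * q ^ n) k)"
      using qpoch_norm_le[OF assms(1), of c n] K M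
      by (intro mult_right_mono mult_mono) (auto simp: M_def)
    finally show "inverse (K * M) \<le> norm (qpoch q (c * q ^ n) k)"
      using K M by (simp add: field_simps)
  qed
qed

subsection \<open>The basic hypergeometric series in the unit disc\<close>

definition phi21_coeff :: "complex \<Rightarrow> complex \<Rightarrow> complex \<Rightarrow> complex \<Rightarrow> nat \<Rightarrow> complex" where
  "phi21_coeff q a b c k = qpoch q a k * qpoch q b k / (qpoch q c k * qpoch q q k)"

lemma phi21_coeff_0 [simp]: "phi21_coeff q a b c 0 = 1"
  by (simp add: phi21_coeff_def)

lemma power_base_nonone:
  assumes "0 < norm (q::complex)" "norm q < 1"
  shows "q * q ^ j \<noteq> 1"
proof
  assume "q * q ^ j = 1"
  then have "norm q ^ Suc j = 1"
    by (metis norm_one norm_power power_Suc)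
  moreover have "norm q ^ Suc j < 1 ^ Suc j"
    by (rule power_strict_mono) (use assms in auto)
  ultimately show False by simp
qed

lemma shifted_nonone:
  assumes "\<And>j. c * q ^ j \<noteq> (1::complex)"
  shows "c * q ^ n * q ^ j \<noteq> 1"
  using assms[of "n + j"] by (simp add: power_add mult_ac)

text \<open>Uniformity in \<open>n\<close> is the point: the same \<open>K\<close> gives convergence
  in the unit disc and the majorant for the limit of \<open>n\<close> to infinity.\<close>

lemma phi21_coeff_bound:
  assumes "0 < norm q" "norm q < 1" "\<And>j. c * q ^ j \<noteq> 1"
  obtains K where "\<And>n k. norm (phi21_coeff q (a * q ^ n) (b * q ^ n) (c * q ^ n) k) \<le> K"
proof -
  have q_pow: "norm q ^ n \<le> 1" for n
    using assms by (simp add: power_le_one)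
  have M: "norm (qpoch q (a * q ^ n) k) \<le> exp (norm a / (1 - norm q))" for a n k
  proof -
    have "norm (qpoch q (a * q ^ n) k) \<le> exp (norm (a * q ^ n) / (1 - norm q))"
      by (rule qpoch_norm_le[OF assms(2)])
    also have "\<dots> \<le> exp (norm a / (1 - norm q))"
      using assms q_pow[of n]
      by (auto simp: norm_mult norm_power intro!: divide_right_mono mult_left_le)
    finally show ?thesis .
  qed
  obtain d where d: "d > 0" "\<And>n k. d \<le> norm (qpoch q (c * q ^ n) k)"
    using qpoch_norm_ge[OF assms(2,3)] by blast
  obtain e where e: "e > 0" "\<And>n k. e \<le> norm (qpoch q (q * q ^ n) k)"
    using qpoch_norm_ge[OF assms(2) power_base_nonone[OF assms(1,2)]] by blast
  show ?thesis
  proof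
    fix n k
    show "norm (phi21_coeff q (a * q ^ n) (b * q ^ n) (c * q ^ n) k)
            \<le> exp (norm a / (1 - norm q)) * exp (norm b / (1 - norm q)) / (d * e)"
      unfolding phi21_coeff_def norm_divide norm_mult
      using d e e(2)[of 0 k] M by (intro frac_le mult_mono) auto
  qed
qed

lemma phi21_summable:
  assumes "0 < norm q" "norm q < 1" "\<And>j. c * q ^ j \<noteq> 1" "norm w < 1"
  shows "summable (\<lambda>k. phi21_coeff q a b c k * w ^ k)"
proof -
  obtain K where K: "\<And>n k. norm (phi21_coeff q (a * q ^ n) (b * q ^ n) (c * q ^ n) k) \<le> K"
    using phi21_coeff_bound[OF assms(1-3)] by blast
  show ?thesis
  proof (rule summable_comparison_test')
    show "summable (\<lambda>k. K * norm w ^ k)"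
      by (intro summable_mult summable_geometric) (use assms in auto)
    show "norm (phi21_coeff q a b c k * w ^ k) \<le> K * norm w ^ k" for k
      using K[of 0 k] by (simp add: norm_mult norm_power mult_right_mono)
  qed
qed

lemma phi21_sums:
  assumes "0 < norm q" "norm q < 1" "\<And>j. c * q ^ j \<noteq> 1" "norm w < 1"
  shows "(\<lambda>k. phi21_coeff q a b c k * w ^ k) sums phi21_series q a b c w"
  using summable_sums[OF phi21_summable[OF assms]]
  by (simp add: phi21_series_def phi21_coeff_def)

lemma phi21_series_holomorphic:
  assumes "0 < norm q" "norm q < 1" "\<And>j. c * q ^ j \<noteq> 1"
  shows "phi21_series q a b c holomorphic_on ball 0 1"
proof (rule power_series_holomorphic)
  show "(\<lambda>k. phi21_coeff q a b c k * (w - 0) ^ k) sums phi21_series q a b c w"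
    if "w \<in> ball 0 1" for w
    using phi21_sums[OF assms, of w a b] that by simp
qed

lemma sums_shift_power:
  fixes f :: "nat \<Rightarrow> complex"
  assumes "(\<lambda>k. f k * w ^ k) sums s"
  shows "(\<lambda>k. (if k = 0 then 0 else f (k - 1)) * w ^ k) sums (w * s)"
proof -
  have "(\<lambda>k. w * (f k * w ^ k)) sums (w * s)"
    by (rule sums_mult[OF assms])
  then have "(\<lambda>k. (if Suc k = 0 then 0 else f (Suc k - 1)) * w ^ Suc k) sums (w * s)"
    by (simp add: mult_ac)
  then show ?thesis
    by (subst (asm) sums_Suc_iff) simp
qed

lemma phi21_coeff_Suc:
  assumes "0 < norm q" "norm q < 1" "\<And>j. c * q ^ j \<noteq> 1"
  shows "phi21_coeff q a b c (Suc k) * ((1 - c * q ^ k) * (1 - q * q ^ k))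
           = phi21_coeff q a b c k * ((1 - a * q ^ k) * (1 - b * q ^ k))"
proof -
  \<comment> \<open>By the convention x / 0 = 0 both sides vanish if \<open>E\<close> or
    \<open>D\<close> is 0, so only the new factors \<open>x\<close> and \<open>y\<close> have to be
    cancelled.\<close>
  have "A * s * (B * t) / (E * x * (D * y)) * (x * y) = A * B / (E * D) * (s * t)"
    if "x \<noteq> 0" "y \<noteq> 0" for A B D E s t x y :: complex
    using that by (cases "E = 0 \<or> D = 0") (auto simp: field_simps)
  then show ?thesis
    unfolding phi21_coeff_def qpoch_Suc
    using assms(3)[of k] power_base_nonone[OF assms(1,2), of k] by simp
qed

text \<open>With T F(w) = F(q w) the relation reads (1 - (c/q) T) (1 - T) F = w (1 - a T) (1 - b T)
  F. Since T multiplies the coefficient of w^k by q^k, this is \<open>phi21_coeff_Suc\<close> in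
  terms of generating functions.\<close>

lemma phi21_q_difference:
  assumes q: "0 < norm q" "norm q < 1" and c: "\<And>j. c * q ^ j \<noteq> 1" and w: "norm w < 1"
  shows "(1 - w) * phi21_series q a b c w
           = (1 + c / q - (a + b) * w) * phi21_series q a b c (q * w)
             - (c / q - a * b * w) * phi21_series q a b c (q ^ 2 * w)"
proof -
  have [simp]: "q \<noteq> 0" using q by auto
  let ?f = "phi21_coeff q a b c"
  have w1: "norm (q * w) < 1"
    using q w mult_strict_mono[of "norm q" 1 "norm w" 1] by (simp add: norm_mult)
  have w2: "norm (q ^ 2 * w) < 1"
    using q w1 mult_strict_mono[of "norm q" 1 "norm (q * w)" 1]
    by (simp add: norm_mult power2_eq_square mult.assoc)
  have s0: "(\<lambda>k. ?f k * w ^ k) sums phi21_series q a b c w"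
    by (rule phi21_sums[OF q c w])
  have s1: "(\<lambda>k. (?f k * q ^ k) * w ^ k) sums phi21_series q a b c (q * w)"
    using phi21_sums[OF q c w1, of a b] by (simp add: power_mult_distrib mult_ac)
  have s2: "(\<lambda>k. (?f k * (q ^ k) ^ 2) * w ^ k) sums phi21_series q a b c (q ^ 2 * w)"
    using phi21_sums[OF q c w2, of a b]
    by (simp add: power_mult_distrib mult_ac flip: power_mult)
  let ?S = "\<lambda>g k. (if k = 0 then 0 else g (k - 1)) :: complex"
  have "(\<lambda>k. ?f k * w ^ k - ?S ?f k * w ^ k - (1 + c / q) * (?f k * q ^ k * w ^ k)
            + (a + b) * (?S (\<lambda>k. ?f k * q ^ k) k * w ^ k) + c / q * (?f k * (q ^ k) ^ 2 * w ^ k)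
            - a * b * (?S (\<lambda>k. ?f k * (q ^ k) ^ 2) k * w ^ k)) sums
          (phi21_series q a b c w - w * phi21_series q a b c w
            - (1 + c / q) * phi21_series q a b c (q * w) + (a + b) * (w * phi21_series q a b c (q * w))
            + c / q * phi21_series q a b c (q ^ 2 * w)
            - a * b * (w * phi21_series q a b c (q ^ 2 * w)))"
    by (intro sums_add sums_diff sums_mult s0 s1 s2 sums_shift_power)
  moreover have "?f k * w ^ k - ?S ?f k * w ^ k - (1 + c / q) * (?f k * q ^ k * w ^ k)
            + (a + b) * (?S (\<lambda>k. ?f k * q ^ k) k * w ^ k) + c / q * (?f k * (q ^ k) ^ 2 * w ^ k)
            - a * b * (?S (\<lambda>k. ?f k * (q ^ k) ^ 2) k * w ^ k) = 0" for k
  proof (cases k)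
    case 0
    then show ?thesis by simp
  next
    case (Suc j)
    \<comment> \<open>Applied with \<open>t\<close> = q^j and \<open>e\<close> = c/q, so that q t is
      q^k and e q t is c q^j.\<close>
    have eq: "x * v - y * v - (1 + e) * (x * (q * t) * v) + (a + b) * (y * t * v)
        + e * (x * (q * t) ^ 2 * v) - a * b * (y * t ^ 2 * v)
        = (x * ((1 - e * q * t) * (1 - q * t)) - y * ((1 - a * t) * (1 - b * t))) * v"
      for x y v t e :: complex
      by algebra
    have "?f k * w ^ k - ?S ?f k * w ^ k - (1 + c / q) * (?f k * q ^ k * w ^ k)
            + (a + b) * (?S (\<lambda>k. ?f k * q ^ k) k * w ^ k) + c / q * (?f k * (q ^ k) ^ 2 * w ^ k)
            - a * b * (?S (\<lambda>k. ?f k * (q ^ k) ^ 2) k * w ^ k)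
        = (?f (Suc j) * ((1 - c * q ^ j) * (1 - q * q ^ j)) - ?f j * ((1 - a * q ^ j) * (1 - b * q ^ j))) * w ^ k"
      using eq[of "?f (Suc j)" "w ^ k" "?f j" "c / q" "q ^ j"] by (simp add: Suc)
    also have "\<dots> = 0"
      by (simp add: phi21_coeff_Suc[OF q c])
    finally show ?thesis .
  qed
  ultimately have "(\<lambda>k. 0) sums
          (phi21_series q a b c w - w * phi21_series q a b c w
            - (1 + c / q) * phi21_series q a b c (q * w) + (a + b) * (w * phi21_series q a b c (q * w))
            + c / q * phi21_series q a b c (q ^ 2 * w)
            - a * b * (w * phi21_series q a b c (q ^ 2 * w)))"
    by simp
  from sums_unique2[OF this sums_zero] show ?thesis
    by (simp add: algebra_simps)
qed

text \<open>This is the coefficient of w^(k+2) in the contiguous relation; from this index on, the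
  shifts by w and w^2 cause no boundary terms. Each term is \<open>h k\<close> times a rational
  function of q^k, so clearing denominators leaves a polynomial identity.\<close>

lemma contiguous_coeff:
  fixes q a b c :: complex and k :: nat
  assumes q: "0 < norm q" "norm q < 1" and c: "\<And>j. c * q ^ j \<noteq> 1"
  defines "f \<equiv> phi21_coeff q a b c"
    and "g \<equiv> phi21_coeff q (a * q) (b * q) (c * q)"
    and "h \<equiv> phi21_coeff q (a * q * q) (b * q * q) (c * q * q)"
  shows "(1 - c) * (1 - c * q) * f (Suc (Suc k))
           = (1 - c) * (1 - c * q) * g (Suc (Suc k))
             + (1 - c * q) * ((1 + q) * a * b - (a + b)) * g (Suc k)
             + c * (1 - a * q) * (1 - b * q) * h (Suc k)
             - a * b * q * (1 - a * q) * (1 - b * q) * h k"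
proof -
  define u where "u = q ^ k"
  have c0: "c \<noteq> 1" and c1: "c * q \<noteq> 1" and c2: "c * q * q * u \<noteq> 1"
    using c[of 0] c[of 1] c[of "Suc (Suc k)"] by (auto simp: u_def mult_ac)
  have q1: "q * u \<noteq> 1" and q2: "q * (q * u) \<noteq> 1"
    using power_base_nonone[OF q, of k] power_base_nonone[OF q, of "Suc k"] by (auto simp: u_def)
  \<comment> \<open>\<open>D\<close> collects the factors depending on \<open>k\<close> that the
    various denominators have beyond that of \<open>h k\<close>; the others, 1 - c and 1 - c q, are
    already prefactors in the claim.\<close>
  define D where "D = (1 - c * q * q * u) * (1 - q * u) * (1 - q * (q * u))"
  have D: "D \<noteq> 0"
    using c2 q1 q2 by (simp add: D_def)
  have "(1 - c) * (1 - c * q) * f (Suc (Suc k)) * D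
      = (1 - a * q) * (1 - b * q) * h k * ((1 - a) * (1 - b) * (1 - c * q * q * u))"
  proof -
    have e: "qpoch q x (Suc (Suc k)) = (1 - x) * (1 - x * q) * qpoch q (x * q * q) k" for x
      by (simp add: qpoch_Suc_shift)
    have "qpoch q q (Suc (Suc k)) = qpoch q q k * ((1 - q * u) * (1 - q * (q * u)))"
      by (simp add: qpoch_Suc u_def)
    then show ?thesis
      unfolding f_def h_def phi21_coeff_def e D_def using c0 c1 q1 q2
      by (simp add: divide_simps)
  qed
  moreover have "(1 - c * q) * g (Suc (Suc k)) * D
      = (1 - a * q) * (1 - b * q) * h k * ((1 - a * q * q * u) * (1 - b * q * q * u))"
  proof -
    have e: "qpoch q (x * q) (Suc (Suc k)) = (1 - x * q) * (qpoch q (x * q * q) k * (1 - x * q * q * u))" for x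
      by (subst qpoch_Suc_shift) (simp add: qpoch_Suc u_def)
    have "qpoch q q (Suc (Suc k)) = qpoch q q k * ((1 - q * u) * (1 - q * (q * u)))"
      by (simp add: qpoch_Suc u_def)
    then show ?thesis
      unfolding g_def h_def phi21_coeff_def e D_def using c1 c2 q1 q2
      by (simp add: divide_simps)
  qed
  moreover have "(1 - c * q) * g (Suc k) * D
      = (1 - a * q) * (1 - b * q) * h k * ((1 - c * q * q * u) * (1 - q * (q * u)))"
  proof -
    have e: "qpoch q (x * q) (Suc k) = (1 - x * q) * qpoch q (x * q * q) k" for x
      by (subst qpoch_Suc_shift) simp
    have "qpoch q q (Suc k) = qpoch q q k * (1 - q * u)"
      by (simp add: qpoch_Suc u_def)
    then show ?thesis
      unfolding g_def h_def phi21_coeff_def e D_def using c1 q1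
      by (simp add: divide_simps)
  qed
  moreover have "h (Suc k) * D
      = h k * ((1 - a * q * q * u) * (1 - b * q * q * u) * (1 - q * (q * u)))"
  proof -
    have e: "qpoch q (x * q * q) (Suc k) = qpoch q (x * q * q) k * (1 - x * q * q * u)" for x
      by (simp add: qpoch_Suc u_def)
    have "qpoch q q (Suc k) = qpoch q q k * (1 - q * u)"
      by (simp add: qpoch_Suc u_def)
    then show ?thesis
      unfolding h_def phi21_coeff_def e D_def using c2 q1
      by (simp add: divide_simps)
  qed
  \<comment> \<open>Once the common factor (1 - a q) (1 - b q) \<open>h k\<close> is split off, this
    identity is all that remains.\<close>
  moreover have "(1 - a) * (1 - b) * (1 - c * q * q * u)
     = (1 - c) * ((1 - a * q * q * u) * (1 - b * q * q * u))
       + ((1 + q) * a * b - (a + b)) * ((1 - c * q * q * u) * (1 - q * (q * u)))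
       + c * ((1 - a * q * q * u) * (1 - b * q * q * u) * (1 - q * (q * u)))
       - a * b * q * D"
    unfolding D_def by algebra
  \<comment> \<open>Stated for free variables, so that the linear combination is formed without
    expanding the concrete coefficients.\<close>
  moreover have "l = x * y \<Longrightarrow> g2 = x * z2 \<Longrightarrow> g1 = x * z1 \<Longrightarrow> h1 = H * t \<Longrightarrow> x = m * n * H \<Longrightarrow>
      y = C * z2 + r * z1 + c * t - v * D \<Longrightarrow> l = C * g2 + r * g1 + c * m * n * h1 - v * m * n * H * D"
    for l x y z1 z2 g1 g2 h1 t m n H C r v :: complex
    by (simp add: ring_distribs mult_ac)
  ultimately have "(1 - c) * (1 - c * q) * f (Suc (Suc k)) * D
     = (1 - c) * ((1 - c * q) * g (Suc (Suc k)) * D)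
             + ((1 + q) * a * b - (a + b)) * ((1 - c * q) * g (Suc k) * D)
             + c * (1 - a * q) * (1 - b * q) * (h (Suc k) * D)
             - a * b * q * (1 - a * q) * (1 - b * q) * h k * D"
    by blast
  also have "\<dots> = ((1 - c) * (1 - c * q) * g (Suc (Suc k))
             + (1 - c * q) * ((1 + q) * a * b - (a + b)) * g (Suc k)
             + c * (1 - a * q) * (1 - b * q) * h (Suc k)
             - a * b * q * (1 - a * q) * (1 - b * q) * h k) * D"
    by algebra
  finally show ?thesis
    using D by simp
qed

lemma phi21_series_contiguous:
  fixes q a b c w :: complex
  assumes q: "0 < norm q" "norm q < 1" and c: "\<And>j. c * q ^ j \<noteq> 1" and w: "norm w < 1"
  shows "(1 - c) * (1 - c * q) * phi21_series q a b c w
           = (1 - c - (a + b) * w + (1 + q) * a * b * w) * (1 - c * q)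
               * phi21_series q (a * q) (b * q) (c * q) w
             + w * (c - a * b * q * w) * (1 - a * q) * (1 - b * q)
               * phi21_series q (a * q * q) (b * q * q) (c * q * q) w"
    (is "?l * ?F = _ * _ * ?G + _ * _ * _ * _ * ?H")
proof -
  have c1: "c * q * q ^ j \<noteq> 1" and c2: "c * q * q * q ^ j \<noteq> 1" for j
    using c[of "Suc j"] c[of "Suc (Suc j)"] by (auto simp: mult_ac)
  let ?f = "phi21_coeff q a b c"
  let ?g = "phi21_coeff q (a * q) (b * q) (c * q)"
  let ?h = "phi21_coeff q (a * q * q) (b * q * q) (c * q * q)"
  let ?S = "\<lambda>g k. (if k = 0 then 0 else g (k - 1)) :: complex"
  have "(\<lambda>k. ?l * (?f k * w ^ k) - ?l * (?g k * w ^ k)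
          - (1 - c * q) * ((1 + q) * a * b - (a + b)) * (?S ?g k * w ^ k)
          - c * (1 - a * q) * (1 - b * q) * (?S ?h k * w ^ k)
          + a * b * q * (1 - a * q) * (1 - b * q) * (?S (?S ?h) k * w ^ k)) sums
        (?l * ?F - ?l * ?G - (1 - c * q) * ((1 + q) * a * b - (a + b)) * (w * ?G)
          - c * (1 - a * q) * (1 - b * q) * (w * ?H)
          + a * b * q * (1 - a * q) * (1 - b * q) * (w * (w * ?H)))"
    by (intro sums_add sums_diff sums_mult sums_shift_power phi21_sums[OF q c w]
          phi21_sums[OF q c1 w] phi21_sums[OF q c2 w])
  moreover have "?l * (?f k * w ^ k) - ?l * (?g k * w ^ k)
          - (1 - c * q) * ((1 + q) * a * b - (a + b)) * (?S ?g k * w ^ k)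
          - c * (1 - a * q) * (1 - b * q) * (?S ?h k * w ^ k)
          + a * b * q * (1 - a * q) * (1 - b * q) * (?S (?S ?h) k * w ^ k) = 0" for k
  proof -
    \<comment> \<open>The double shift of \<open>?h\<close> starts at index 2, so the constant and
      the linear coefficient are checked by hand.\<close>
    consider "k = 0" | "k = 1" | j where "k = Suc (Suc j)"
      by (metis One_nat_def not0_implies_Suc)
    then show ?thesis
    proof cases
      case 1
      then show ?thesis by simp
    next
      case 2
      have "1 - c \<noteq> 0" "1 - c * q \<noteq> 0" "1 - q \<noteq> 0"
        using c[of 0] c[of 1] q by auto
      then have "?l * ?f 1 = (1 - a) * (1 - b) * (1 - c * q) / (1 - q)"
          and "?l * ?g 1 = (1 - c) * (1 - a * q) * (1 - b * q) / (1 - q)"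
        by (simp_all add: phi21_coeff_def qpoch_def divide_simps)
      moreover have eq: "(1 - a) * (1 - b) * (1 - c * q) / (1 - q)
          - (1 - c) * (1 - a * q) * (1 - b * q) / (1 - q)
          - (1 - c * q) * ((1 + q) * a * b - (a + b)) - c * (1 - a * q) * (1 - b * q) = 0"
        using \<open>1 - q \<noteq> 0\<close> by (simp add: divide_simps) algebra
      ultimately have A: "?l * ?f 1 - ?l * ?g 1 - (1 - c * q) * ((1 + q) * a * b - (a + b))
          - c * (1 - a * q) * (1 - b * q) = 0"
        by metis
      have B: "x * (x' * v) - x * (y' * v) - z * v - t * v = (x * x' - x * y' - z - t) * v"
        for x x' y' z t v :: complex
        by algebra
      have "?l * (?f 1 * w) - ?l * (?g 1 * w) - (1 - c * q) * ((1 + q) * a * b - (a + b)) * w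
          - c * (1 - a * q) * (1 - b * q) * w = 0"
        unfolding B A by simp
      then show ?thesis
        using 2 by simp
    next
      case 3
      have "?l * ?f k - ?l * ?g k - (1 - c * q) * ((1 + q) * a * b - (a + b)) * ?g (Suc j)
          - c * (1 - a * q) * (1 - b * q) * ?h (Suc j)
          + a * b * q * (1 - a * q) * (1 - b * q) * ?h j = 0"
        unfolding 3 contiguous_coeff[OF q c] by simp
      moreover have "x * (x' * v) - x * (y' * v) - z * (z' * v) - t * (t' * v) + u * (u' * v)
          = (x * x' - x * y' - z * z' - t * t' + u * u') * v" for x x' y' z z' t t' u u' v :: complex
        by algebra
      ultimately show ?thesis
        using 3 by simp
    qed
  qed
  ultimately have "?l * ?F - ?l * ?G - (1 - c * q) * ((1 + q) * a * b - (a + b)) * (w * ?G)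
          - c * (1 - a * q) * (1 - b * q) * (w * ?H)
          + a * b * q * (1 - a * q) * (1 - b * q) * (w * (w * ?H)) = 0"
    using sums_unique2[OF _ sums_zero] by simp
  then show ?thesis
    by algebra
qed

subsection \<open>The entire function behind the continuation\<close>

text \<open>The right-hand side of the \<open>q\<close>-difference equation \<open>phi21_q_difference\<close>, multiplied by
  \<open>qpoch_inf q w\<close>, only involves values at \<open>q * w\<close> and \<open>q\<^sup>2 * w\<close>, so each use of it
  enlarges the disc of holomorphy by the factor \<open>1 / norm q\<close>.\<close>

primrec phi21_ext :: "complex \<Rightarrow> complex \<Rightarrow> complex \<Rightarrow> complex \<Rightarrow> nat \<Rightarrow> complex \<Rightarrow> complex" where
  "phi21_ext q a b c 0 = (\<lambda>w. qpoch_inf q w * phi21_series q a b c w)"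
| "phi21_ext q a b c (Suc m) = (\<lambda>w. (1 + c / q - (a + b) * w) * phi21_ext q a b c m (q * w)
     - (c / q - a * b * w) * (1 - q * w) * phi21_ext q a b c m (q ^ 2 * w))"

text \<open>The least index is a mere choice: by \<open>phi21_ext_le_eq\<close> every stage whose
  disc contains \<open>w\<close> gives the same value.\<close>

definition phi21_entire :: "complex \<Rightarrow> complex \<Rightarrow> complex \<Rightarrow> complex \<Rightarrow> complex \<Rightarrow> complex" where
  "phi21_entire q a b c w = phi21_ext q a b c (LEAST m. norm w * norm q ^ m < 1) w"

lemma q_scaled_bound:
  assumes "0 < norm (q::complex)" "norm q < 1" "norm w * norm q ^ Suc m < 1"
  shows "norm (q * w) * norm q ^ m < 1" and "norm (q ^ 2 * w) * norm q ^ m < 1"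
proof -
  show *: "norm (q * w) * norm q ^ m < 1"
    using assms by (simp add: norm_mult mult_ac)
  have "norm (q ^ 2 * w) * norm q ^ m = norm q * (norm (q * w) * norm q ^ m)"
    by (simp add: norm_mult power2_eq_square)
  also have "\<dots> \<le> 1 * (norm (q * w) * norm q ^ m)"
    by (rule mult_right_mono) (use assms in auto)
  finally show "norm (q ^ 2 * w) * norm q ^ m < 1"
    using * by simp
qed

lemma phi21_ext_holomorphic:
  assumes q: "0 < norm q" "norm q < 1" and c: "\<And>j. c * q ^ j \<noteq> 1"
  shows "phi21_ext q a b c m holomorphic_on {w. norm w * norm q ^ m < 1}"
proof (induction m)
  case 0
  have "{w. norm w * norm q ^ 0 < 1} = (ball 0 1 :: complex set)"
    by auto
  then show ?case
    using phi21_series_holomorphic[OF q c, of a b] qpoch_inf_holomorphic[OF q(2)]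
    by (auto intro!: holomorphic_intros elim: holomorphic_on_subset)
next
  case (Suc m)
  let ?U = "\<lambda>m. {w. norm w * norm q ^ m < 1}"
  have "(phi21_ext q a b c m \<circ> (\<lambda>w. q * w)) holomorphic_on ?U (Suc m)"
    by (rule holomorphic_on_compose_gen[OF _ Suc])
      (use q_scaled_bound(1)[OF q] in \<open>auto intro!: holomorphic_intros\<close>)
  moreover have "(phi21_ext q a b c m \<circ> (\<lambda>w. q ^ 2 * w)) holomorphic_on ?U (Suc m)"
    by (rule holomorphic_on_compose_gen[OF _ Suc])
      (use q_scaled_bound(2)[OF q] in \<open>auto intro!: holomorphic_intros\<close>)
  ultimately show ?case
    by (auto simp: o_def intro!: holomorphic_intros)
qed

text \<open>On the unit disc this is the q-difference equation times (w)_infinity: one factor 1 - w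
  is absorbed by passing to (q w)_infinity, and a further 1 - q w is split off to reach (q^2
  w)_infinity. Larger discs follow by applying the induction hypothesis at q w and q^2 w.\<close>

lemma phi21_ext_Suc_eq:
  assumes q: "0 < norm q" "norm q < 1" and c: "\<And>j. c * q ^ j \<noteq> 1"
  shows "norm w * norm q ^ m < 1 \<Longrightarrow> phi21_ext q a b c (Suc m) w = phi21_ext q a b c m w"
proof (induction m arbitrary: w)
  case 0
  then have w: "norm w < 1" by simp
  have "qpoch_inf q w * phi21_series q a b c w
      = qpoch_inf q (q * w) * ((1 - w) * phi21_series q a b c w)"
    using qpoch_inf_shift[OF q(2), of w] by (simp add: mult_ac)
  also have "\<dots> = qpoch_inf q (q * w) * ((1 + c / q - (a + b) * w) * phi21_series q a b c (q * w)
             - (c / q - a * b * w) * phi21_series q a b c (q ^ 2 * w))"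
    by (simp only: phi21_q_difference[OF q c w])
  also have "\<dots> = (1 + c / q - (a + b) * w) * (qpoch_inf q (q * w) * phi21_series q a b c (q * w))
      - (c / q - a * b * w) * (1 - q * w)
        * (qpoch_inf q (q ^ 2 * w) * phi21_series q a b c (q ^ 2 * w))"
  proof -
    have "x * (s * f - t * g) = s * (x * f) - t * u * (y * g)" if "x = u * y"
      for x y u s t f g :: complex
      using that by algebra
    moreover have "qpoch_inf q (q * w) = (1 - q * w) * qpoch_inf q (q ^ 2 * w)"
      using qpoch_inf_shift[OF q(2), of "q * w"] by (simp add: power2_eq_square mult_ac)
    ultimately show ?thesis by blast
  qed
  finally show ?case
    by (simp only: phi21_ext.simps)
next
  case (Suc m)
  show ?case
    using Suc.IH[OF q_scaled_bound(1)[OF q Suc.prems]] Suc.IH[OF q_scaled_bound(2)[OF q Suc.prems]]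
    by (subst (1 2) phi21_ext.simps(2)) simp
qed

lemma phi21_ext_le_eq:
  assumes q: "0 < norm q" "norm q < 1" and c: "\<And>j. c * q ^ j \<noteq> 1"
    and "norm w * norm q ^ m < 1" "m \<le> n"
  shows "phi21_ext q a b c n w = phi21_ext q a b c m w"
  using assms(5)
proof (induction n rule: dec_induct)
  case (step n)
  have "norm q ^ n \<le> norm q ^ m"
    by (rule power_decreasing) (use q step in auto)
  then have "norm w * norm q ^ n < 1"
    using assms(4) by (meson le_less_trans mult_left_mono norm_ge_zero)
  then show ?case
    using phi21_ext_Suc_eq[OF q c, of w n a b] step by simp
qed simp

lemma phi21_entire_eq_ext:
  assumes q: "0 < norm q" "norm q < 1" and c: "\<And>j. c * q ^ j \<noteq> 1" and "norm w * norm q ^ m < 1"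
  shows "phi21_entire q a b c w = phi21_ext q a b c m w"
  unfolding phi21_entire_def
  by (rule phi21_ext_le_eq[OF q c, symmetric]) (use assms(4) in \<open>auto intro: LeastI Least_le\<close>)

lemma exists_scaled_bound:
  assumes "norm (q::complex) < 1"
  shows "\<exists>m. norm (w::complex) * norm q ^ m < 1"
proof -
  have "(\<lambda>m. norm w * norm q ^ m) \<longlonglongrightarrow> norm w * 0"
    by (intro tendsto_intros LIMSEQ_power_zero) (use assms in simp)
  then have "eventually (\<lambda>m. norm w * norm q ^ m < 1) sequentially"
    by (rule order_tendstoD) simp
  then show ?thesis
    by (auto simp: eventually_sequentially)
qed

lemma phi21_entire_holomorphic:
  assumes q: "0 < norm q" "norm q < 1" and c: "\<And>j. c * q ^ j \<noteq> 1"
  shows "phi21_entire q a b c holomorphic_on UNIV"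
proof -
  have "phi21_entire q a b c analytic_on {w}" for w
  proof -
    obtain m where m: "norm w * norm q ^ m < 1"
      using exists_scaled_bound[OF q(2)] by blast
    have "open {w. norm w * norm q ^ m < 1}"
      by (intro open_Collect_less continuous_intros)
    moreover have "phi21_entire q a b c holomorphic_on {w. norm w * norm q ^ m < 1}"
      using phi21_ext_holomorphic[OF q c, of a b m]
      by (rule holomorphic_transform) (use phi21_entire_eq_ext[OF q c] in auto)
    ultimately show ?thesis
      using m by (auto simp: analytic_at)
  qed
  then show ?thesis
    by (metis analytic_imp_holomorphic analytic_on_analytic_at)
qed

lemma phi21_entire_disc:
  assumes q: "0 < norm q" "norm q < 1" and c: "\<And>j. c * q ^ j \<noteq> 1" and w: "norm w < 1"
  shows "phi21_entire q a b c w = qpoch_inf q w * phi21_series q a b c w"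
  using phi21_entire_eq_ext[OF q c, of w 0 a b] w by simp

text \<open>On the unit disc the series relation is multiplied by (w)_infinity, which is the same in
  all three terms. Both sides are entire, so the identity theorem applies.\<close>

lemma phi21_entire_contiguous:
  fixes q a b c w :: complex
  assumes q: "0 < norm q" "norm q < 1" and c: "\<And>j. c * q ^ j \<noteq> 1"
  shows "(1 - c) * (1 - c * q) * phi21_entire q a b c w
           = (1 - c - (a + b) * w + (1 + q) * a * b * w) * (1 - c * q)
               * phi21_entire q (a * q) (b * q) (c * q) w
             + w * (c - a * b * q * w) * (1 - a * q) * (1 - b * q)
               * phi21_entire q (a * q * q) (b * q * q) (c * q * q) w"
proof -
  have c1: "c * q * q ^ j \<noteq> 1" and c2: "c * q * q * q ^ j \<noteq> 1" for j
    using c[of "Suc j"] c[of "Suc (Suc j)"] by (auto simp: mult_ac)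
  let ?L = "\<lambda>w. (1 - c) * (1 - c * q) * phi21_entire q a b c w"
  let ?R = "\<lambda>w. (1 - c - (a + b) * w + (1 + q) * a * b * w) * (1 - c * q)
               * phi21_entire q (a * q) (b * q) (c * q) w
             + w * (c - a * b * q * w) * (1 - a * q) * (1 - b * q)
               * phi21_entire q (a * q * q) (b * q * q) (c * q * q) w"
  have "?L w - ?R w = 0"
  proof (rule analytic_continuation[where f = "\<lambda>w. ?L w - ?R w" and U = "ball 0 1" and S = UNIV and \<xi> = 0])
    show "(\<lambda>w. ?L w - ?R w) holomorphic_on UNIV"
      by (intro holomorphic_intros phi21_entire_holomorphic[OF q c]
          phi21_entire_holomorphic[OF q c1] phi21_entire_holomorphic[OF q c2])
    show "?L w - ?R w = 0" if "w \<in> ball 0 1" for w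
    proof -
      have "norm w < 1" using that by simp
      then show ?thesis
        using phi21_series_contiguous[OF q c, of w a b]
        unfolding phi21_entire_disc[OF q c \<open>norm w < 1\<close>]
          phi21_entire_disc[OF q c1 \<open>norm w < 1\<close>] phi21_entire_disc[OF q c2 \<open>norm w < 1\<close>]
        by algebra
    qed
    show "0 islimpt (ball 0 1 :: complex set)"
      by (simp add: islimpt_ball)
  qed auto
  then show ?thesis by simp
qed

subsection \<open>Limits in the parameters and the meromorphic continuation\<close>

text \<open>This is Euler's identity. With zero parameters the q-difference equation becomes G(v) =
  G(q v); iterating and using continuity at 0 gives G(v) = G(0) = 1 on the disc.\<close>

lemma phi21_entire_zero_params:
  assumes q: "0 < norm q" "norm q < 1"
  shows "phi21_entire q 0 0 0 w = 1"
proof -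
  let ?G = "phi21_entire q 0 0 0"
  have hol: "?G holomorphic_on UNIV"
    by (rule phi21_entire_holomorphic[OF q]) simp
  have disc: "?G v = qpoch_inf q v * phi21_series q 0 0 0 v" if "norm v < 1" for v
    by (rule phi21_entire_disc[OF q _ that]) simp
  have step: "?G v = ?G (q * v)" if v: "norm v < 1" for v
  proof -
    have "norm (q * v) < 1"
      using q v mult_strict_mono[of "norm q" 1 "norm v" 1] by (simp add: norm_mult)
    then show ?thesis
      using phi21_q_difference[OF q _ v, of 0 0 0] qpoch_inf_shift[OF q(2), of v]
      by (simp add: disc v mult_ac)
  qed
  have const: "?G v = 1" if v: "norm v < 1" for v
  proof -
    have "?G v = ?G (q ^ m * v)" for m
    proof (induction m)
      case (Suc m)
      have "norm (q ^ m * v) < 1"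
        using q v power_le_one[of "norm q" m] mult_le_less_imp_less[of "norm q ^ m" 1 "norm v" 1]
        by (cases "v = 0") (auto simp: norm_mult norm_power)
      from step[OF this] Suc show ?case by (simp add: mult_ac)
    qed simp
    moreover have "(\<lambda>m. ?G (q ^ m * v)) \<longlonglongrightarrow> ?G (0 * v)"
    proof (rule isCont_tendsto_compose[where g = ?G])
      show "isCont ?G (0 * v)"
        using holomorphic_on_imp_continuous_on[OF hol] by (simp add: continuous_on_eq_continuous_at)
      show "(\<lambda>m. q ^ m * v) \<longlonglongrightarrow> 0 * v"
        by (intro tendsto_intros LIMSEQ_power_zero) (use q in simp)
    qed
    ultimately have "?G v = ?G 0"
      by (simp add: LIMSEQ_const_iff)
    also have "?G 0 = 1"
      by (simp add: disc phi21_series_def qpoch_inf_def)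
    finally show ?thesis .
  qed
  have "?G w - 1 = 0"
    by (rule analytic_continuation[where f = "\<lambda>w. ?G w - 1" and U = "ball 0 1" and S = UNIV and \<xi> = 0])
      (use hol const in \<open>auto intro!: holomorphic_intros simp: islimpt_ball\<close>)
  then show ?thesis by simp
qed

lemma param_tendsto_0:
  assumes "norm (q::complex) < 1"
  shows "(\<lambda>n. a * q ^ n) \<longlonglongrightarrow> 0"
  using tendsto_mult[OF tendsto_const LIMSEQ_power_zero[OF assms], of a] by simp

text \<open>Termwise limits are legitimate by Tannery's theorem with majorant K |w|^k.\<close>

lemma phi21_series_tendsto:
  assumes q: "0 < norm q" "norm q < 1" and c: "\<And>j. c * q ^ j \<noteq> 1" and w: "norm w < 1"
  shows "(\<lambda>n. phi21_series q (a * q ^ n) (b * q ^ n) (c * q ^ n) w) \<longlonglongrightarrow> phi21_series q 0 0 0 w"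
proof -
  obtain K where K: "\<And>n k. norm (phi21_coeff q (a * q ^ n) (b * q ^ n) (c * q ^ n) k) \<le> K"
    using phi21_coeff_bound[OF q c] by blast
  have one: "(\<lambda>n. qpoch q (x * q ^ n) k) \<longlonglongrightarrow> 1" for x k
  proof -
    have "(\<lambda>n. qpoch q (x * q ^ n) k) \<longlonglongrightarrow> (\<Prod>j<k. 1 - 0 * q ^ j)"
      unfolding qpoch_def by (intro tendsto_intros param_tendsto_0 q)
    then show ?thesis by simp
  qed
  have "(\<lambda>n. \<Sum>k. phi21_coeff q (a * q ^ n) (b * q ^ n) (c * q ^ n) k * w ^ k)
          \<longlonglongrightarrow> (\<Sum>k. phi21_coeff q 0 0 0 k * w ^ k)"
  proof (rule tannerys_theorem[THEN conjunct2, THEN conjunct2])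
    fix k
    have "qpoch q q k \<noteq> 0"
      by (rule qpoch_nonzero[OF power_base_nonone[OF q]])
    then have "(\<lambda>n. phi21_coeff q (a * q ^ n) (b * q ^ n) (c * q ^ n) k * w ^ k)
        \<longlonglongrightarrow> 1 * 1 / (1 * qpoch q q k) * w ^ k"
      unfolding phi21_coeff_def by (intro tendsto_intros one) auto
    then show "(\<lambda>n. phi21_coeff q (a * q ^ n) (b * q ^ n) (c * q ^ n) k * w ^ k)
        \<longlonglongrightarrow> phi21_coeff q 0 0 0 k * w ^ k"
      by (simp add: phi21_coeff_def qpoch_def)
  next
    show "eventually (\<lambda>(k, n). norm (phi21_coeff q (a * q ^ n) (b * q ^ n) (c * q ^ n) k * w ^ k)
            \<le> K * norm w ^ k) (at_top \<times>\<^sub>F sequentially)"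
      by (rule always_eventually) (use K in \<open>auto simp: norm_mult norm_power intro!: mult_right_mono\<close>)
    show "summable (\<lambda>k. K * norm w ^ k)"
      by (intro summable_mult summable_geometric) (use w in auto)
  qed simp
  then show ?thesis
    by (simp add: phi21_series_def phi21_coeff_def)
qed

text \<open>Outside the unit disc the limit is carried from stage to stage: as the parameters tend
  to 0, the two coefficients in the recursion of \<open>phi21_ext\<close> tend to 1 and 0, so the
  limit 1 is preserved.\<close>

lemma phi21_entire_tendsto:
  assumes q: "0 < norm q" "norm q < 1" and c: "\<And>j. c * q ^ j \<noteq> 1"
  shows "(\<lambda>n. phi21_entire q (a * q ^ n) (b * q ^ n) (c * q ^ n) w) \<longlonglongrightarrow> 1"
proof -
  have c': "c * q ^ n * q ^ j \<noteq> 1" for n j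
    by (rule shifted_nonone[OF c])
  have ext: "norm w * norm q ^ m < 1 \<Longrightarrow>
      (\<lambda>n. phi21_ext q (a * q ^ n) (b * q ^ n) (c * q ^ n) m w) \<longlonglongrightarrow> 1" for m w
  proof (induction m arbitrary: w)
    case 0
    then have w: "norm w < 1" by simp
    have "(\<lambda>n. qpoch_inf q w * phi21_series q (a * q ^ n) (b * q ^ n) (c * q ^ n) w)
        \<longlonglongrightarrow> qpoch_inf q w * phi21_series q 0 0 0 w"
      by (intro tendsto_intros phi21_series_tendsto[OF q c w])
    also have "qpoch_inf q w * phi21_series q 0 0 0 w = 1"
      using phi21_entire_disc[OF q _ w, of 0 0 0] phi21_entire_zero_params[OF q] by simp
    finally show ?case by simp
  next
    case (Suc m)
    have "q \<noteq> 0" using q by auto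
    then have "(\<lambda>n. phi21_ext q (a * q ^ n) (b * q ^ n) (c * q ^ n) (Suc m) w)
        \<longlonglongrightarrow> (1 + 0 / q - (0 + 0) * w) * 1 - (0 / q - 0 * 0 * w) * (1 - q * w) * 1"
      unfolding phi21_ext.simps
      by (intro tendsto_intros param_tendsto_0 q Suc.IH q_scaled_bound[OF q Suc.prems])
    then show ?case by simp
  qed
  obtain m where m: "norm w * norm q ^ m < 1"
    using exists_scaled_bound[OF q(2)] by blast
  show ?thesis
    using ext[OF m] by (simp add: phi21_entire_eq_ext[OF q c' m])
qed

text \<open>A meromorphic function on the plane is constantly 0 or avoids 0, each up to a sparse
  set, and the disc rules out the latter. The conclusion concerns punctured neighbourhoods because
  \<open>meromorphic_on\<close> does not constrain values at isolated points.\<close>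

lemma meromorphic_zero_on_disc_imp_eventually_zero:
  assumes "f meromorphic_on UNIV" "\<And>w. norm w < 1 \<Longrightarrow> f w = 0"
  shows "eventually (\<lambda>v. f v = 0) (at z)"
proof -
  have "\<not> eventually (\<lambda>v. f v \<noteq> 0) (cosparse UNIV)"
  proof
    assume "eventually (\<lambda>v. f v \<noteq> 0) (cosparse UNIV)"
    then have "eventually (\<lambda>v. f v \<noteq> 0) (at 0)"
      by (rule eventually_cosparse_imp_eventually_at) auto
    moreover have "eventually (\<lambda>v. v \<in> ball 0 1) (at (0::complex))"
      by (rule eventually_at_in_open') auto
    ultimately have "eventually (\<lambda>v::complex. False) (at 0)"
      by eventually_elim (use assms(2) in auto)
    then show False by simp
  qed
  then have "eventually (\<lambda>v. f v = 0) (cosparse UNIV)"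
    using meromorphic_imp_constant_or_avoid[OF assms(1), of 0] by auto
  then show ?thesis
    by (rule eventually_cosparse_imp_eventually_at) auto
qed

text \<open>Uniqueness for the description in \<open>phi21\<close>. Agreement on punctured
  neighbourhoods forces the same poles, where both values are 0, and the same limits elsewhere,
  which are the values.\<close>

lemma nicely_meromorphic_eqI:
  assumes f: "f nicely_meromorphic_on UNIV" and g: "g nicely_meromorphic_on UNIV"
    and eq: "\<And>w. norm w < 1 \<Longrightarrow> f w = g w"
  shows "f = g"
proof
  fix z
  have "(\<lambda>w. f w - g w) meromorphic_on UNIV"
    using f g by (auto simp: nicely_meromorphic_on_def intro!: meromorphic_intros)
  then have "eventually (\<lambda>w. f w - g w = 0) (at z)"
    by (rule meromorphic_zero_on_disc_imp_eventually_zero) (simp add: eq)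
  then have ev: "eventually (\<lambda>w. f w = g w) (at z)"
    by simp
  have pole: "is_pole f z \<longleftrightarrow> is_pole g z"
    by (rule is_pole_cong[OF ev refl])
  show "f z = g z"
  proof (cases "is_pole f z")
    case True
    then have "\<not> f \<midarrow>z\<rightarrow> f z" "\<not> g \<midarrow>z\<rightarrow> g z"
      using pole unfolding is_pole_def
      by (metis at_neq_bot not_tendsto_and_filterlim_at_infinity)+
    then have "f z = 0" "g z = 0"
      using f g unfolding nicely_meromorphic_on_def by blast+
    then show ?thesis by simp
  next
    case False
    then have "f \<midarrow>z\<rightarrow> f z" "g \<midarrow>z\<rightarrow> g z"
      using pole f g unfolding nicely_meromorphic_on_def by auto
    then have "g \<midarrow>z\<rightarrow> f z"
      using tendsto_cong[OF ev] by blast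
    with \<open>g \<midarrow>z\<rightarrow> g z\<close> show ?thesis
      by (metis LIM_unique)
  qed
qed

lemma
  assumes q: "0 < norm q" "norm q < 1" and c: "\<And>j. c * q ^ j \<noteq> 1"
  shows phi21_nicely_meromorphic: "phi21 q a b c nicely_meromorphic_on UNIV"
    and phi21_disc: "norm w < 1 \<Longrightarrow> phi21 q a b c w = phi21_series q a b c w"
proof -
  \<comment> \<open>The witness for existence is a quotient of entire functions whose denominator
    has no zero in the open unit disc.\<close>
  define F where "F = remove_sings (\<lambda>w. phi21_entire q a b c w / qpoch_inf q w)"
  let ?P = "\<lambda>F. F nicely_meromorphic_on UNIV \<and> (\<forall>w. norm w < 1 \<longrightarrow> F w = phi21_series q a b c w)"
  have "?P F"
  proof (intro conjI allI impI)
    have "(\<lambda>w. phi21_entire q a b c w / qpoch_inf q w) meromorphic_on UNIV"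
      using phi21_entire_holomorphic[OF q c, of a b] qpoch_inf_holomorphic[OF q(2)]
      by (intro meromorphic_on_divide analytic_on_imp_meromorphic_on)
        (simp_all add: analytic_on_open)
    then show "F nicely_meromorphic_on UNIV"
      unfolding F_def by (rule remove_sings_nicely_meromorphic)
  next
    fix w :: complex assume w: "norm w < 1"
    have "w * q ^ j \<noteq> 1" for j
    proof
      assume "w * q ^ j = 1"
      then have "norm w * norm q ^ j = 1"
        by (metis norm_mult norm_one norm_power)
      moreover have "norm w * norm q ^ j \<le> norm w * 1"
        by (rule mult_left_mono) (use q in \<open>auto intro: power_le_one\<close>)
      ultimately show False using w by simp
    qed
    then have nz: "qpoch_inf q w \<noteq> 0"
      by (rule qpoch_inf_nonzero[OF q(2)])
    then have "(\<lambda>w. phi21_entire q a b c w / qpoch_inf q w) analytic_on {w}"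
      using phi21_entire_holomorphic[OF q c, of a b] qpoch_inf_holomorphic[OF q(2)]
      by (intro analytic_intros)
        (auto intro: analytic_on_subset[of _ UNIV] simp: analytic_on_open)
    then show "F w = phi21_series q a b c w"
      unfolding F_def using nz by (simp add: phi21_entire_disc[OF q c w])
  qed
  moreover have "G = F" if "?P G" for G
    by (rule nicely_meromorphic_eqI) (use that \<open>?P F\<close> in auto)
  ultimately have "?P (phi21 q a b c)"
    unfolding phi21_def by (rule theI)
  then show "phi21 q a b c nicely_meromorphic_on UNIV"
    and "norm w < 1 \<Longrightarrow> phi21 q a b c w = phi21_series q a b c w"
    by auto
qed

text \<open>The point \<open>w\<close> may be a zero of (w)_infinity, so division is avoided: the
  identity holds near \<open>w\<close> and passes to \<open>w\<close> by continuity. At a pole the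
  right-hand side would be 0 by convention, whereas the left-hand side need not vanish.\<close>

lemma phi21_entire_eq_phi21:
  assumes q: "0 < norm q" "norm q < 1" and c: "\<And>j. c * q ^ j \<noteq> 1"
    and "\<not> is_pole (phi21 q a b c) w"
  shows "phi21_entire q a b c w = qpoch_inf q w * phi21 q a b c w"
proof -
  have mero: "phi21 q a b c nicely_meromorphic_on UNIV"
    by (rule phi21_nicely_meromorphic[OF q c])
  have hol: "phi21_entire q a b c holomorphic_on UNIV" "qpoch_inf q holomorphic_on UNIV"
    using phi21_entire_holomorphic[OF q c] qpoch_inf_holomorphic[OF q(2)] by auto
  then have cont: "isCont (phi21_entire q a b c) w" "isCont (qpoch_inf q) w"
    using holomorphic_on_imp_continuous_on continuous_on_eq_continuous_at[OF open_UNIV] by blast+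
  have mero': "phi21_entire q a b c meromorphic_on UNIV" "qpoch_inf q meromorphic_on UNIV"
    using hol by (auto intro!: analytic_on_imp_meromorphic_on simp: analytic_on_open)
  have "(\<lambda>v. qpoch_inf q v * phi21 q a b c v - phi21_entire q a b c v) meromorphic_on UNIV"
    using mero mero' by (intro meromorphic_intros) (auto simp: nicely_meromorphic_on_def)
  then have "eventually (\<lambda>v. qpoch_inf q v * phi21 q a b c v - phi21_entire q a b c v = 0) (at w)"
    by (rule meromorphic_zero_on_disc_imp_eventually_zero)
      (simp add: phi21_disc[OF q c] phi21_entire_disc[OF q c])
  then have "(\<lambda>v. qpoch_inf q v * phi21 q a b c v - phi21_entire q a b c v) \<midarrow>w\<rightarrow> 0"
    by (rule tendsto_eventually)
  moreover have "(\<lambda>v. qpoch_inf q v * phi21 q a b c v - phi21_entire q a b c v)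
      \<midarrow>w\<rightarrow> qpoch_inf q w * phi21 q a b c w - phi21_entire q a b c w"
    using mero assms(4) cont by (intro tendsto_intros) (auto simp: nicely_meromorphic_on_def isCont_def)
  ultimately have "qpoch_inf q w * phi21 q a b c w - phi21_entire q a b c w = 0"
    by (rule LIM_unique[symmetric])
  then show ?thesis by simp
qed

subsection \<open>Continued fractions from solutions of the recurrence\<close>

text \<open>The right-hand sides are independent of \<open>n\<close>: inserting the recurrence for
  \<open>X (Suc n)\<close> and regrouping produces the next numerator or denominator.\<close>

lemma continued_fraction_backward_identity:
  assumes "\<And>n. X n = d n * X (Suc n) + c (Suc n) * X (Suc (Suc n))"
  shows "X 0 = cf_den c d (Suc n) * X (Suc n) + c (Suc n) * cf_den c d n * X (Suc (Suc n))"
    and "c 0 * X 1 = cf_num c d (Suc n) * X (Suc n) + c (Suc n) * cf_num c d n * X (Suc (Suc n))"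
proof (induction n)
  case 0
  {
    case 1
    show ?case using assms[of 0] by simp
  next
    case 2
    show ?case by simp
  }
next
  case (Suc n)
  {
    case 1
    show ?case
      using Suc(1) assms[of "Suc n"] by (simp add: algebra_simps)
  next
    case 2
    show ?case
      using Suc(2) assms[of "Suc n"] by (simp add: algebra_simps)
  }
qed

text \<open>After division by z^n, each step enlarges the maximum of two consecutive terms by at
  most a factor 1 + \<open>g n\<close>; summability of \<open>g\<close> bounds the product of these
  factors.\<close>

lemma perturbed_recurrence_bounded:
  fixes u e f :: "nat \<Rightarrow> complex" and z :: complex
  assumes z: "z \<noteq> 0"
    and e: "summable (\<lambda>n. norm (e n))" and f: "summable (\<lambda>n. norm (f n))"
    and u: "\<And>n. u (Suc (Suc n)) = (z - e n) * u (Suc n) + f n * u n"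
  obtains K where "\<And>n. norm (u n) \<le> K * norm z ^ n"
proof -
  define g where "g n = norm (e n) / norm z + norm (f n) / norm z ^ 2" for n
  have g0: "g n \<ge> 0" for n
    by (simp add: g_def)
  have g: "summable g"
    unfolding g_def by (intro summable_add summable_divide e f)
  define v where "v n = u n / z ^ n" for n
  define M where "M n = (norm (v 0) + norm (v 1)) * (\<Prod>i<n. 1 + g i)" for n
  have M0: "M n \<ge> 0" for n
    unfolding M_def by (intro mult_nonneg_nonneg prod_nonneg) (auto simp: g0 intro: add_nonneg_nonneg)
  have M_Suc: "M (Suc n) = M n * (1 + g n)" for n
    by (simp add: M_def)
  have M_mono: "M n \<le> M (Suc n)" for n
    unfolding M_Suc using M0[of n] g0[of n] by (simp add: distrib_left)
  have v: "v (Suc (Suc n)) = (1 - e n / z) * v (Suc n) + f n / z ^ 2 * v n" for n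
    using z by (simp add: v_def u divide_simps power2_eq_square)
  have bound: "norm (v n) \<le> M n \<and> norm (v (Suc n)) \<le> M n" for n
  proof (induction n)
    case (Suc n)
    have "norm (v (Suc (Suc n))) \<le> norm (1 - e n / z) * norm (v (Suc n)) + norm (f n / z ^ 2) * norm (v n)"
      unfolding v using norm_triangle_ineq by (metis norm_mult)
    also have "\<dots> \<le> (1 + norm (e n / z)) * M n + norm (f n / z ^ 2) * M n"
      using Suc norm_triangle_ineq4[of 1 "e n / z"] M0
      by (intro add_mono mult_mono) auto
    also have "\<dots> = M (Suc n)"
      unfolding M_Suc g_def by (simp add: norm_divide norm_power algebra_simps)
    finally show ?case
      using Suc M_mono[of n] by linarith
  qed (simp add: M_def)
  define K where "K = (norm (v 0) + norm (v 1)) * exp (suminf g)"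
  show ?thesis
  proof
    fix n
    have "(\<Prod>i<n. 1 + g i) \<le> (\<Prod>i<n. exp (g i))"
      by (intro prod_mono) (auto simp: g0 intro: add_nonneg_nonneg exp_ge_add_one_self)
    also have "\<dots> \<le> exp (suminf g)"
      using sum_le_suminf[OF g, of "{..<n}"] g0 by (simp flip: exp_sum)
    finally have "M n \<le> K"
      unfolding M_def K_def by (intro mult_left_mono) auto
    then have "norm (v n) \<le> K"
      using bound[of n] by simp
    then show "norm (u n) \<le> K * norm z ^ n"
      using z by (simp add: v_def norm_divide norm_power field_simps)
  qed
qed

text \<open>After rescaling by powers of z, the second term of \<open>eq\<close> is a null sequence
  times bounded ones, so the first term tends to \<open>s\<close> and can be divided by the limit
  \<open>l\<close>.\<close>

lemma recurrence_solution_limit: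
  fixes u c X :: "nat \<Rightarrow> complex"
  assumes z: "z \<noteq> 0" and K: "\<And>n. norm (u n) \<le> K * norm z ^ n" and c: "c \<longlonglongrightarrow> 0"
    and X: "(\<lambda>n. X n * z ^ n) \<longlonglongrightarrow> l" and l: "l \<noteq> 0"
    and eq: "\<And>n. s = u (Suc n) * X (Suc n) + c (Suc n) * u n * X (Suc (Suc n))"
  shows "(\<lambda>n. u n / z ^ n) \<longlonglongrightarrow> s / l"
proof -
  define v where "v n = u n / z ^ n" for n
  define Y where "Y n = X n * z ^ n" for n
  have Y: "Y \<longlonglongrightarrow> l" using X unfolding Y_def .
  have v: "norm (v n) \<le> K" for n
    using K[of n] z by (simp add: v_def norm_divide norm_power field_simps)
  have "(\<lambda>n. c (Suc n) / z ^ 2 * Y (Suc (Suc n))) \<longlonglongrightarrow> 0 / z ^ 2 * l"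
    using z LIMSEQ_Suc[OF c] LIMSEQ_Suc[OF LIMSEQ_Suc[OF Y]] by (intro tendsto_intros) auto
  then have "(\<lambda>n. c (Suc n) / z ^ 2 * Y (Suc (Suc n)) * v n) \<longlonglongrightarrow> 0"
    using v by (intro lim_null_mult_right_bounded[where B = K and g = v]) auto
  then have "(\<lambda>n. s - c (Suc n) / z ^ 2 * Y (Suc (Suc n)) * v n) \<longlonglongrightarrow> s - 0"
    by (intro tendsto_intros)
  moreover have "s - c (Suc n) / z ^ 2 * Y (Suc (Suc n)) * v n = v (Suc n) * Y (Suc n)" for n
    using eq[of n] z by (simp add: v_def Y_def field_simps power2_eq_square)
  ultimately have "(\<lambda>n. v (Suc n) * Y (Suc n)) \<longlonglongrightarrow> s"
    by simp
  then have "(\<lambda>n. v (Suc n) * Y (Suc n) / Y (Suc n)) \<longlonglongrightarrow> s / l"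
    using LIMSEQ_Suc[OF Y] l by (rule tendsto_divide)
  moreover have "eventually (\<lambda>n. v (Suc n) * Y (Suc n) / Y (Suc n) = v (Suc n)) sequentially"
    using tendsto_imp_eventually_ne[OF LIMSEQ_Suc[OF Y] l] by eventually_elim simp
  ultimately have "(\<lambda>n. v (Suc n)) \<longlonglongrightarrow> s / l"
    by (rule Lim_transform_eventually)
  then show ?thesis
    unfolding v_def by (rule LIMSEQ_imp_Suc)
qed

text \<open>Scaled by z^(-n), denominators and numerators tend to \<open>X 0 / l\<close> and
  \<open>c 0 * X 1 / l\<close>, so \<open>l\<close> cancels; \<open>X 0 \<noteq> 0\<close> also
  keeps the denominators eventually nonzero.\<close>

lemma continued_fraction_value:
  fixes c e X :: "nat \<Rightarrow> complex"
  assumes z: "z \<noteq> 0"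
    and e: "summable (\<lambda>n. norm (e n))" and c: "summable (\<lambda>n. norm (c n))"
    and X: "\<And>n. X n = (z - e n) * X (Suc n) + c (Suc n) * X (Suc (Suc n))"
    and lim: "(\<lambda>n. X n * z ^ n) \<longlonglongrightarrow> l" and l: "l \<noteq> 0" and X0: "X 0 \<noteq> 0"
  shows "cf_has_value c (\<lambda>n. z - e n) (c 0 * X 1 / X 0)"
proof -
  let ?d = "\<lambda>n. z - e n"
  have e': "summable (\<lambda>n. norm (e (Suc n)))" and c': "summable (\<lambda>n. norm (c (Suc n)))"
    using e c by (simp_all add: summable_Suc_iff[of "\<lambda>n. norm (e n)"] summable_Suc_iff[of "\<lambda>n. norm (c n)"])
  have c0: "c \<longlonglongrightarrow> 0"
    using summable_LIMSEQ_zero[OF c] by (rule tendsto_norm_zero_cancel)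
  have den: "(\<lambda>n. cf_den c ?d n / z ^ n) \<longlonglongrightarrow> X 0 / l"
  proof -
    have "cf_den c ?d (Suc (Suc n)) = (z - e (Suc n)) * cf_den c ?d (Suc n) + c (Suc n) * cf_den c ?d n" for n
      by simp
    then obtain K where K: "\<And>n. norm (cf_den c ?d n) \<le> K * norm z ^ n"
      using perturbed_recurrence_bounded[where u = "cf_den c ?d", OF z e' c'] by blast
    show ?thesis
      by (rule recurrence_solution_limit[where u = "cf_den c ?d" and X = X, OF z K c0 lim l])
        (rule continued_fraction_backward_identity(1)[where X = X and d = ?d, OF X])
  qed
  have num: "(\<lambda>n. cf_num c ?d n / z ^ n) \<longlonglongrightarrow> c 0 * X 1 / l"
  proof -
    have "cf_num c ?d (Suc (Suc n)) = (z - e (Suc n)) * cf_num c ?d (Suc n) + c (Suc n) * cf_num c ?d n" for n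
      by simp
    then obtain K where K: "\<And>n. norm (cf_num c ?d n) \<le> K * norm z ^ n"
      using perturbed_recurrence_bounded[where u = "cf_num c ?d", OF z e' c'] by blast
    show ?thesis
      by (rule recurrence_solution_limit[where u = "cf_num c ?d" and X = X, OF z K c0 lim l])
        (rule continued_fraction_backward_identity(2)[where X = X and d = ?d, OF X])
  qed
  have "X 0 / l \<noteq> 0" using X0 l by simp
  from tendsto_imp_eventually_ne[OF den this]
  have "eventually (\<lambda>n. cf_den c ?d n \<noteq> 0) sequentially"
    by eventually_elim auto
  moreover have "(\<lambda>n. (cf_num c ?d n / z ^ n) / (cf_den c ?d n / z ^ n)) \<longlonglongrightarrow> (c 0 * X 1 / l) / (X 0 / l)"
    by (intro tendsto_divide num den) fact
  ultimately show ?thesis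
    unfolding cf_has_value_def using z l by simp
qed

subsection \<open>The associated big q-Laguerre continued fraction\<close>

theorem mainTheorem7:
  fixes q A B C z :: complex and a b :: "nat \<Rightarrow> complex"
  assumes "0 < norm q" and "norm q < 1"
    and "A \<noteq> 0" and "B \<noteq> 0" and "C \<noteq> 0"
    and "\<And>n. a n = (1 / A + 1 / B + 1 / C) * q ^ n - (1 + q) * q powi (2 * int n - 1)"
    and "\<And>n. n \<ge> 1 \<Longrightarrow> (b n)\<^sup>2 =
           - (q ^ n / (A * B * C)) * (1 - A * q ^ (n - 1)) * (1 - B * q ^ (n - 1)) * (1 - C * q ^ (n - 1))"
    and "\<And>n. n \<ge> 1 \<Longrightarrow> (b n)\<^sup>2 \<noteq> 0"
    and "z \<noteq> 0"
    and "\<And>k::nat. q / (A * z) \<noteq> q powi (- int k)"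
    and "\<And>k::nat. 1 / (A * z) \<noteq> q powi (- int k)"
    and "\<not> is_pole (phi21 q B C (q / (A * z))) (q / (B * C * z))"
    and "\<not> is_pole (phi21 q (B / q) (C / q) (1 / (A * z))) (q / (B * C * z))"
    and "z * (1 - 1 / (A * z)) * phi21 q (B / q) (C / q) (1 / (A * z)) (q / (B * C * z)) \<noteq> 0"
  shows "cf_has_value (\<lambda>n. if n = 0 then 1 else - (b n)\<^sup>2) (\<lambda>n. z - a n)
           (phi21 q B C (q / (A * z)) (q / (B * C * z)) /
             (z * (1 - 1 / (A * z)) * phi21 q (B / q) (C / q) (1 / (A * z)) (q / (B * C * z))))"
proof -
  note q = assms(1,2)
  have nz: "q \<noteq> 0" "A \<noteq> 0" "B \<noteq> 0" "C \<noteq> 0" "z \<noteq> 0"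
    using assms by auto
  \<comment> \<open>The parameters are those of the denominator of the claim; multiplied by q they
    become those of the numerator, so the two functions belong to \<open>G 0\<close> and
    \<open>G 1\<close>.\<close>
  define \<alpha> where "\<alpha> = B / q"
  define \<beta> where "\<beta> = C / q"
  define \<gamma> where "\<gamma> = 1 / (A * z)"
  define w where "w = q / (B * C * z)"
  define cc where "cc = (\<lambda>n. if n = 0 then 1 else - (b n)\<^sup>2)"
  define G where "G n = phi21_entire q (\<alpha> * q ^ n) (\<beta> * q ^ n) (\<gamma> * q ^ n) w" for n
  define X where "X n = G n / (qpoch q \<gamma> n * z ^ n)" for n
  have \<gamma>: "\<gamma> * q ^ j \<noteq> 1" for j
  proof
    assume "\<gamma> * q ^ j = 1"
    then have "1 / (A * z) = q powi (- int j)"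
      using nz by (simp add: \<gamma>_def power_int_minus field_simps)
    then show False using assms(11) by blast
  qed
  then have qp: "qpoch q \<gamma> n \<noteq> 0" for n
    by (rule qpoch_nonzero)

  \<comment> \<open>The exponent 2 n - 1 is negative at n = 0; pulling out 1/q leaves two geometric
    sequences.\<close>
  have a_eq: "a n = (1 / A + 1 / B + 1 / C) * q ^ n - (1 + q) / q * (q ^ 2) ^ n" for n
  proof -
    have "q powi (2 * int n - 1) = (q ^ 2) ^ n / q"
      using nz by (simp add: power_int_diff power_int_mult power_mult)
    then show ?thesis
      unfolding assms(6) by simp
  qed
  have cc_Suc: "cc (Suc n) = q ^ Suc n / (A * B * C) * (1 - A * q ^ n) * (1 - B * q ^ n) * (1 - C * q ^ n)" for n
    using assms(7)[of "Suc n"] by (simp add: cc_def)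

  have X_rec: "X n = (z - a n) * X (Suc n) + cc (Suc n) * X (Suc (Suc n))" for n
  proof -
    define t where "t = q ^ n"
    have "(1 - \<gamma> * t) * (1 - \<gamma> * t * q) * G n
        = (1 - \<gamma> * t - (\<alpha> * t + \<beta> * t) * w + (1 + q) * (\<alpha> * t) * (\<beta> * t) * w) * (1 - \<gamma> * t * q) * G (Suc n)
          + w * (\<gamma> * t - \<alpha> * t * (\<beta> * t) * q * w) * (1 - \<alpha> * t * q) * (1 - \<beta> * t * q) * G (Suc (Suc n))"
      using phi21_entire_contiguous[OF q shifted_nonone[OF \<gamma>], of n "\<alpha> * t" "\<beta> * t" w]
      by (simp add: G_def t_def mult_ac)
    \<comment> \<open>Here \<alpha> w = 1/(C z), \<beta> w = 1/(B z) and \<alpha> \<beta> w = 1/(q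
      z).\<close>
    moreover have "1 - \<gamma> * t - (\<alpha> * t + \<beta> * t) * w + (1 + q) * (\<alpha> * t) * (\<beta> * t) * w = (z - a n) / z"
    proof -
      have "(q ^ 2) ^ n = t * t"
        by (simp add: t_def power2_eq_square power_mult_distrib)
      then show ?thesis
        using nz by (simp add: a_eq flip: t_def) (simp add: \<alpha>_def \<beta>_def \<gamma>_def w_def field_simps)
    qed
    moreover have "w * (\<gamma> * t - \<alpha> * t * (\<beta> * t) * q * w) * (1 - \<alpha> * t * q) * (1 - \<beta> * t * q) = cc (Suc n) / z ^ 2"
    proof -
      have e: "\<alpha> * t * q = B * t" "\<beta> * t * q = C * t"
        using nz by (simp_all add: \<alpha>_def \<beta>_def)
      \<comment> \<open>The factor 1 - A t arises because \<alpha> \<beta> q w = 1/z = A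
        \<gamma>.\<close>
      have e': "w * (\<gamma> * t - \<alpha> * t * (\<beta> * t) * q * w) = q * t / (A * B * C) * (1 - A * t) / z ^ 2"
        using nz by (simp add: \<alpha>_def \<beta>_def \<gamma>_def w_def divide_simps power2_eq_square) (simp add: algebra_simps)
      show ?thesis
        unfolding e e' cc_Suc by (simp add: t_def mult_ac)
    qed
    ultimately have *: "(1 - \<gamma> * t) * (1 - \<gamma> * t * q) * G n
        = (z - a n) / z * (1 - \<gamma> * t * q) * G (Suc n) + cc (Suc n) / z ^ 2 * G (Suc (Suc n))"
      by simp
    have t1: "1 - \<gamma> * t \<noteq> 0" and t2: "1 - \<gamma> * t * q \<noteq> 0"
      using \<gamma>[of n] \<gamma>[of "Suc n"] by (simp_all add: t_def mult_ac)
    have P1: "qpoch q \<gamma> (Suc n) = qpoch q \<gamma> n * (1 - \<gamma> * t)"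
      and P2: "qpoch q \<gamma> (Suc (Suc n)) = qpoch q \<gamma> n * ((1 - \<gamma> * t) * (1 - \<gamma> * t * q))"
      by (simp_all add: qpoch_Suc t_def mult_ac)
    have "X n = (1 - \<gamma> * t) * (1 - \<gamma> * t * q) * G n / (qpoch q \<gamma> (Suc (Suc n)) * z ^ n)"
      unfolding X_def P2 using t1 t2 by simp
    also have "\<dots> = (z - a n) * X (Suc n) + cc (Suc n) * X (Suc (Suc n))"
      unfolding * X_def P1 P2 using t1 t2 nz qp[of n]
      by (simp add: add_divide_distrib power2_eq_square mult_ac)
    finally show ?thesis .
  qed

  have "(\<lambda>n. G n / qpoch q \<gamma> n) \<longlonglongrightarrow> 1 / qpoch_inf q \<gamma>"
    unfolding G_def
    by (intro tendsto_divide phi21_entire_tendsto[OF q \<gamma>] qpoch_tendsto[OF q(2)] qpoch_inf_nonzero[OF q(2) \<gamma>])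
  then have lim: "(\<lambda>n. X n * z ^ n) \<longlonglongrightarrow> 1 / qpoch_inf q \<gamma>"
    using nz by (simp add: X_def)
  have lim_nz: "1 / qpoch_inf q \<gamma> \<noteq> 0"
    using qpoch_inf_nonzero[OF q(2) \<gamma>] by simp

  have G0: "G 0 = qpoch_inf q w * phi21 q (B / q) (C / q) (1 / (A * z)) w"
    using phi21_entire_eq_phi21[OF q, of \<gamma> \<alpha> \<beta> w] \<gamma> assms(13)
    by (simp add: G_def \<alpha>_def \<beta>_def \<gamma>_def w_def)
  have G1: "G 1 = qpoch_inf q w * phi21 q B C (q / (A * z)) w"
    using phi21_entire_eq_phi21[OF q shifted_nonone[OF \<gamma>, of 1], of B C w] nz assms(12)
    by (simp add: G_def \<alpha>_def \<beta>_def \<gamma>_def w_def)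
  \<comment> \<open>A zero of \<open>qpoch_inf q\<close> at \<open>w\<close> would mean that both continuations have a removable
    singularity there; as \<open>b n \<noteq> 0\<close>, the recurrence would then force \<open>X = 0\<close>.\<close>
  have w_nz: "qpoch_inf q w \<noteq> 0"
  proof
    assume w0: "qpoch_inf q w = 0"
    have X_zero: "X n = 0 \<and> X (Suc n) = 0" for n
    proof (induction n)
      case 0
      show ?case using G0 G1 w0 by (simp add: X_def)
    next
      case (Suc n)
      then have Xn: "X n = 0" "X (Suc n) = 0"
        by blast+
      have "cc (Suc n) \<noteq> 0"
        using assms(8)[of "Suc n"] by (simp add: cc_def)
      moreover have "cc (Suc n) * X (Suc (Suc n)) = 0"
        using X_rec[of n] unfolding Xn by simp
      ultimately show ?case
        using Xn by simp
    qed
    have "(\<lambda>n. X n * z ^ n) \<longlonglongrightarrow> 0"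
      by (simp add: X_zero)
    from LIMSEQ_unique[OF lim this] show False
      using lim_nz by blast
  qed
  have phi0: "phi21 q (B / q) (C / q) (1 / (A * z)) w \<noteq> 0"
    using assms(14) by (auto simp: w_def)

  have "summable (\<lambda>n. norm (a n))"
  proof (rule summable_comparison_test')
    show "summable (\<lambda>n. norm (1 / A + 1 / B + 1 / C) * norm q ^ n + norm ((1 + q) / q) * (norm q ^ 2) ^ n)"
      by (intro summable_add summable_mult summable_geometric) (use q in \<open>auto simp: power_less_one_iff\<close>)
    show "norm (norm (a n)) \<le> norm (1 / A + 1 / B + 1 / C) * norm q ^ n + norm ((1 + q) / q) * (norm q ^ 2) ^ n" for n
      unfolding a_eq real_norm_def abs_norm_cancel
      by (rule norm_triangle_ineq4[THEN order_trans]) (simp add: norm_mult norm_power norm_divide)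
  qed
  \<comment> \<open>The closed form \<open>cc_Suc\<close> starts at index 1, so the outer numerator
    \<open>cc 0\<close> = 1 is split off.\<close>
  moreover have "summable (\<lambda>n. norm (cc n))"
  proof (subst summable_Suc_iff[symmetric], rule summable_comparison_test')
    let ?L = "(1 + norm A) * (1 + norm B) * (1 + norm C) * norm q / norm (A * B * C)"
    show "summable (\<lambda>n. ?L * norm q ^ n)"
      by (intro summable_mult summable_geometric) (use q in simp)
    fix n
    have le: "norm (1 - x * q ^ n) \<le> 1 + norm x" for x
    proof -
      have "norm (1 - x * q ^ n) \<le> 1 + norm x * norm q ^ n"
        using norm_triangle_ineq4[of 1 "x * q ^ n"] by (simp add: norm_mult norm_power)
      also have "norm x * norm q ^ n \<le> norm x"
        using q by (intro mult_left_le) (auto intro: power_le_one)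
      finally show ?thesis by simp
    qed
    have "norm (cc (Suc n)) = norm q * norm q ^ n / norm (A * B * C)
        * (norm (1 - A * q ^ n) * norm (1 - B * q ^ n) * norm (1 - C * q ^ n))"
      unfolding cc_Suc by (simp add: norm_mult norm_divide norm_power)
    also have "\<dots> \<le> norm q * norm q ^ n / norm (A * B * C) * ((1 + norm A) * (1 + norm B) * (1 + norm C))"
      by (intro mult_left_mono mult_mono le) auto
    finally show "norm (norm (cc (Suc n))) \<le> ?L * norm q ^ n"
      by (simp add: mult_ac)
  qed
  moreover have "X 0 \<noteq> 0"
    using G0 w_nz phi0 by (simp add: X_def)
  ultimately have "cf_has_value cc (\<lambda>n. z - a n) (cc 0 * X 1 / X 0)"
    using continued_fraction_value[where X = X and e = a and c = cc, OF nz(5) _ _ X_rec lim lim_nz] by blast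
  moreover have "cc 0 * X 1 / X 0 = phi21 q B C (q / (A * z)) w /
      (z * (1 - 1 / (A * z)) * phi21 q (B / q) (C / q) (1 / (A * z)) w)"
  proof -
    have "X 0 = qpoch_inf q w * phi21 q (B / q) (C / q) (1 / (A * z)) w"
      by (simp add: X_def G0)
    moreover have "X 1 = qpoch_inf q w * phi21 q B C (q / (A * z)) w / ((1 - 1 / (A * z)) * z)"
      by (simp only: X_def G1) (simp add: qpoch_def \<gamma>_def)
    ultimately show ?thesis
      using w_nz by (simp add: cc_def mult_ac)
  qed
  ultimately show ?thesis
    by (simp add: cc_def w_def)
qed

end
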